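(* Let $R$ be a commutative ring with $1$ in which $2$ is invertible, and let $n\ge 2$. Then $\mathrm{ESp}_{2n}(R)=H(R)$; that is, the elementary symplectic group $\mathrm{ESp}_{2n}(R)$ coincides with its subgroup $H(R)$ generated by the matrices $E^k(A(a))$, $E^k(B(a))$, $E^k(C(a))$, $E^k(D(a))$, with $a\in R$ and $2\le k\le n$.
   Context: Let $\psi_1=\begin{pmatrix}0&1\\-1&0\end{pmatrix}$ and let $\psi_n$ be the $2n\times 2n$ block diagonal matrix with $n$ diagonal blocks equal to $\psi_1$. $\mathrm{Sp}_{2n}(R)=\{\alpha\in \mathrm{SL}_{2n}(R): \alpha^t\psi_n\alpha=\psi_n\}$. Let $e_{ij}$ be the $2n\times 2n$ matrix with $1$ in position $(i,j)$ and $0$ elsewhere, $E_{ij}(\lambda)=I_{2n}+\lambda e_{ij}$ for $i\neq j$, and let $\pi$ be the permutation $(1\,2)(3\,4)\cdots(2n-1\;2n)$. For $1\le i\ne j\le 2n$ with $j\neq\pi(i)$, put $S_{ij}(\lambda)=I_{2n}+\lambda e_{ij}-(-1)^{i+j}\lambda e_{\pi(j)\pi(i)}$. The elementary symplectic group $\mathrm{ESp}_{2n}(R)$ is the subgroup of $\mathrm{Sp}_{2n}(R)$ generated by all $E_{21}(x)$, $E_{12}(x)$ ($x\in R$) and all $S_{ij}(\lambda)$ ($\lambda\in R$, $i\ne j$, $j\ne\pi(i)$). For $a\in R$ define the $2\times2$ matrices $A(a)=\begin{pmatrix}a&a\\ a&a\end{pmatrix}$, $B(a)=\begin{pmatrix}a&-a\\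 a&-a\end{pmatrix}$, $C(a)=\begin{pmatrix}a&a\\ -a&-a\end{pmatrix}$, $D(a)=\begin{pmatrix}-a&a\\ a&-a\end{pmatrix}$. View $2n\times 2n$ matrices as $n\times n$ block matrices with $2\times 2$ blocks. For $2\le k\le n$ and $X\in M_2(R)$ with $\det X=0$, $E^k(X)$ denotes the $2n\times2n$ matrix with $2\times 2$ identity blocks on the diagonal, block $X$ in block position $(1,k)$, block $\psi_1X^t\psi_1$ in block position $(k,1)$, and zero blocks elsewhere; it lies in $\mathrm{Sp}_{2n}(R)$. $H(R)$ is the subgroup of $\mathrm{ESp}_{2n}(R)$ generated by all $E^k(A(a)),E^k(B(a)),E^k(C(a)),E^k(D(a))$ with $a\in R$, $2\le k\le n$. *)

theory Defs
  imports "Jordan_Normal_Form.Determinant" "HOL-Algebra.Generated_Groups"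
begin

text \<open>
  Rows, columns and blocks of matrices are counted from \<open>0\<close>, as in
  \<^theory>\<open>Jordan_Normal_Form.Matrix\<close>; so the usual \<open>E\<^sub>1\<^sub>2\<close>, \<open>E\<^sub>2\<^sub>1\<close> are
  \<open>E\<close> at \<open>(0,1)\<close>, \<open>(1,0)\<close>, and the block columns \<open>2, \<dots>, n\<close> are \<open>1, \<dots>, n - 1\<close>.
\<close>

definition psi1 :: "'a :: comm_ring_1 mat" where
  "psi1 = mat_of_rows_list 2 [[0, 1], [-1, 0]]"

definition psi :: "nat \<Rightarrow> 'a :: comm_ring_1 mat" where
  "psi n = diag_block_mat (replicate n psi1)"

definition Sp :: "nat \<Rightarrow> 'a :: comm_ring_1 mat set" where
  "Sp n = {\<alpha> \<in> carrier_mat (2 * n) (2 * n).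
             det \<alpha> = 1 \<and> transpose_mat \<alpha> * psi n * \<alpha> = psi n}"

definition Sp_group :: "nat \<Rightarrow> 'a :: comm_ring_1 mat monoid" where
  "Sp_group n = \<lparr>carrier = Sp n, mult = (*), one = 1\<^sub>m (2 * n)\<rparr>"

definition unit_mat :: "nat \<Rightarrow> nat \<Rightarrow> nat \<Rightarrow> 'a :: comm_ring_1 mat" where
  "unit_mat n i j = mat (2 * n) (2 * n) (\<lambda>(r, s). if r = i \<and> s = j then 1 else 0)"

definition elem_mat :: "nat \<Rightarrow> nat \<Rightarrow> nat \<Rightarrow> 'a :: comm_ring_1 \<Rightarrow> 'a mat" where
  "elem_mat n i j x = 1\<^sub>m (2 * n) + x \<cdot>\<^sub>m unit_mat n i j"

text \<open>The permutation \<open>(1 2)(3 4)\<dots>\<close>, which reads \<open>(0 1)(2 3)\<dots>\<close> when counting from \<open>0\<close>.\<close>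

definition swap_index :: "nat \<Rightarrow> nat" where
  "swap_index i = (if even i then i + 1 else i - 1)"

text \<open>The sign \<open>(-1)\<^sup>i\<^sup>+\<^sup>j\<close> does not change when both indices are shifted by one.\<close>

definition symp_elem_mat :: "nat \<Rightarrow> nat \<Rightarrow> nat \<Rightarrow> 'a :: comm_ring_1 \<Rightarrow> 'a mat" where
  "symp_elem_mat n i j x =
     1\<^sub>m (2 * n) + x \<cdot>\<^sub>m unit_mat n i j
       - ((-1) ^ (i + j) * x) \<cdot>\<^sub>m unit_mat n (swap_index j) (swap_index i)"

definition ESp :: "nat \<Rightarrow> 'a :: comm_ring_1 mat set" where
  "ESp n = generate (Sp_group n)
     ({elem_mat n 1 0 x | x. True} \<union> {elem_mat n 0 1 x | x. True} \<union>
      {symp_elem_mat n i j x | i j x.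
         i < 2 * n \<and> j < 2 * n \<and> i \<noteq> j \<and> j \<noteq> swap_index i})"

definition block_A :: "'a :: comm_ring_1 \<Rightarrow> 'a mat" where
  "block_A a = mat_of_rows_list 2 [[a, a], [a, a]]"

definition block_B :: "'a :: comm_ring_1 \<Rightarrow> 'a mat" where
  "block_B a = mat_of_rows_list 2 [[a, -a], [a, -a]]"

definition block_C :: "'a :: comm_ring_1 \<Rightarrow> 'a mat" where
  "block_C a = mat_of_rows_list 2 [[a, a], [-a, -a]]"

definition block_D :: "'a :: comm_ring_1 \<Rightarrow> 'a mat" where
  "block_D a = mat_of_rows_list 2 [[-a, a], [a, -a]]"

text \<open>
  Entry \<open>(r, s)\<close> lies in block \<open>(r div 2, s div 2)\<close>, at position \<open>(r mod 2, s mod 2)\<close> of it.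
  The result is symplectic when \<open>X\<close> is a \<open>2 \<times> 2\<close> matrix of determinant \<open>0\<close> and \<open>0 < k < n\<close>.
\<close>

definition symp_block_mat :: "nat \<Rightarrow> nat \<Rightarrow> 'a :: comm_ring_1 mat \<Rightarrow> 'a mat" where
  "symp_block_mat n k X = mat (2 * n) (2 * n) (\<lambda>(r, s).
     if r div 2 = 0 \<and> s div 2 = k then X $$ (r mod 2, s mod 2)
     else if r div 2 = k \<and> s div 2 = 0
       then (psi1 * transpose_mat X * psi1) $$ (r mod 2, s mod 2)
     else if r = s then 1 else 0)"

definition H :: "nat \<Rightarrow> 'a :: comm_ring_1 mat set" where
  "H n = generate (Sp_group n)
     {symp_block_mat n k X | k X. 1 \<le> k \<and> k < n \<and>
        (\<exists>a. X \<in> {block_A a, block_B a, block_C a, block_D a})}"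

lemma psi_carrier: "psi n \<in> carrier_mat (2 * n) (2 * n)"
proof -
  have "dim_row (psi n :: 'a mat) = 2 * n \<and> dim_col (psi n :: 'a mat) = 2 * n"
    unfolding psi_def by (induction n) (auto simp: psi1_def mat_of_rows_list_def Let_def)
  then show ?thesis by auto
qed

lemma group_Sp: "group (Sp_group n :: 'a :: comm_ring_1 mat monoid)"
proof (rule groupI)
  let ?G = "Sp_group n :: 'a mat monoid" and ?p = "psi n :: 'a mat" and ?N = "2 * n"
  note p = psi_carrier[of n, where 'a = 'a]
  show "\<one>\<^bsub>?G\<^esub> \<in> carrier ?G"
    using p by (auto simp: Sp_group_def Sp_def)
  fix x assume "x \<in> carrier ?G"
  then have x: "x \<in> carrier_mat ?N ?N" "det x = 1" "transpose_mat x * ?p * x = ?p"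
    by (auto simp: Sp_group_def Sp_def)
  show "\<one>\<^bsub>?G\<^esub> \<otimes>\<^bsub>?G\<^esub> x = x" using x by (auto simp: Sp_group_def)
  let ?y = "adj_mat x"
  have y: "?y \<in> carrier_mat ?N ?N" "x * ?y = 1\<^sub>m ?N" "?y * x = 1\<^sub>m ?N"
    using adj_mat[OF x(1)] x(2) by auto
  have "det x * det ?y = 1" using det_mult[OF x(1) y(1)] y(2) by simp
  then have dy: "det ?y = 1" using x(2) by simp
  have ty: "transpose_mat ?y * transpose_mat x = 1\<^sub>m ?N"
    using transpose_mult[OF x(1) y(1)] y(2) by simp
  have "transpose_mat ?y * ?p * ?y = transpose_mat ?y * (transpose_mat x * ?p * x) * ?y"
    using x(3) by simp
  also have "\<dots> = (transpose_mat ?y * transpose_mat x) * ?p * (x * ?y)"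
    using x(1) y(1) p by (simp add: assoc_mult_mat[of _ ?N ?N _ ?N _ ?N])
  also have "\<dots> = ?p" using ty y(2) p by simp
  finally show "\<exists>y\<in>carrier ?G. y \<otimes>\<^bsub>?G\<^esub> x = \<one>\<^bsub>?G\<^esub>"
    using y dy by (intro bexI[of _ ?y]) (auto simp: Sp_group_def Sp_def)
  fix z assume "z \<in> carrier ?G"
  then have z: "z \<in> carrier_mat ?N ?N" "det z = 1" "transpose_mat z * ?p * z = ?p"
    by (auto simp: Sp_group_def Sp_def)
  have "transpose_mat (x * z) * ?p * (x * z) = transpose_mat z * (transpose_mat x * ?p * x) * z"
    using x(1) z(1) p by (simp add: transpose_mult assoc_mult_mat[of _ ?N ?N _ ?N _ ?N])
  also have "\<dots> = ?p" using x(3) z(3) by simp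
  finally show "x \<otimes>\<^bsub>?G\<^esub> z \<in> carrier ?G"
    using x z by (auto simp: Sp_group_def Sp_def det_mult[of _ ?N])
  fix w assume "w \<in> carrier ?G"
  then have "w \<in> carrier_mat ?N ?N" by (auto simp: Sp_group_def Sp_def)
  then show "x \<otimes>\<^bsub>?G\<^esub> z \<otimes>\<^bsub>?G\<^esub> w = x \<otimes>\<^bsub>?G\<^esub> (z \<otimes>\<^bsub>?G\<^esub> w)"
    using x(1) z(1) by (simp add: Sp_group_def assoc_mult_mat[of _ ?N ?N _ ?N _ ?N])
qed

end

theory Submission
  imports Defs
begin

text \<open>
  All generators of both groups are Eichler transformations
  \<open>T(x, y) = 1 + x y\<^sup>t \<psi> + y x\<^sup>t \<psi>\<close> with \<open>x\<close>, \<open>y\<close> orthogonal for the symplectic form \<open>\<omega>\<close>. They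
  satisfy \<open>T(u, v) T(u, w) = T(u, v + w + \<omega>(v, w) u / 2)\<close>. Hence if \<open>b\<close>, \<open>c\<close> are orthogonal to \<open>u\<close>
  with \<open>\<omega>(b, c)\<close> a unit, the \<open>T(u, \<lambda> b)\<close> and \<open>T(u, \<lambda> c)\<close> yield by commutators all \<open>T(u, \<lambda> u)\<close>, and
  then all \<open>T(u, v)\<close> with \<open>v\<close> in the span of \<open>b\<close> and \<open>c\<close>. Applied in both arguments of \<open>T\<close>, this
  shows that the group generated by the \<open>T(\<lambda> x, y)\<close>, with \<open>x\<close> in a basis of the first hyperbolic plane
  and \<open>y\<close> in a basis of the \<open>k\<close>-th one, does not depend on the bases. The standard bases give
  \<open>S\<^sub>i\<^sub>j\<close> for \<open>i\<close> and \<open>j\<close> in the blocks \<open>1\<close> and \<open>k\<close>, the bases \<open>e + f\<close>, \<open>e - f\<close> give the generators of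
  \<open>H\<close>. The remaining \<open>S\<^sub>i\<^sub>j\<close> arise by conjugating \<open>T(e\<^sub>i, e\<^sub>2)\<close> with \<open>T(e\<^sub>1, e\<^sub>j)\<close>.
\<close>

section \<open>The symplectic form and products of Eichler transformations\<close>

text \<open>
  Vectors of length \<open>2 n\<close> are functions on all of \<open>nat\<close>, of which only the values below \<open>2 n\<close> matter.
\<close>

definition basis_fun :: "nat \<Rightarrow> nat \<Rightarrow> 'a :: comm_ring_1" where
  "basis_fun i t = (if t = i then 1 else 0)"

text \<open>The row vector \<open>x\<^sup>t \<psi>\<close>.\<close>

definition covec :: "(nat \<Rightarrow> 'a :: comm_ring_1) \<Rightarrow> nat \<Rightarrow> 'a" where
  "covec x t = (if even t then - x (t + 1) else x (t - 1))"

definition symp_form :: "nat \<Rightarrow> (nat \<Rightarrow> 'a :: comm_ring_1) \<Rightarrow> (nat \<Rightarrow> 'a) \<Rightarrow> 'a" where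
  "symp_form n x y = (\<Sum>k<n. x (2 * k) * y (2 * k + 1) - x (2 * k + 1) * y (2 * k))"

definition eichler :: "nat \<Rightarrow> (nat \<Rightarrow> 'a :: comm_ring_1) \<Rightarrow> (nat \<Rightarrow> 'a) \<Rightarrow> 'a mat" where
  "eichler n x y = mat (2 * n) (2 * n)
     (\<lambda>(r, s). (if r = s then 1 else 0) + x r * covec y s + y r * covec x s)"

text \<open>Grouping coordinates in pairs shows that \<open>covec x\<close> represents the
  functional \<open>symp_form n x\<close>; this turns every contraction inside a matrix product into
  a value of the form.\<close>

lemma sum_covec: "(\<Sum>t<2 * n. covec x t * y t) = symp_form n x y"
  by (induction n) (auto simp: symp_form_def covec_def)

lemma symp_form_self [simp]: "symp_form n x x = 0"
  by (simp add: symp_form_def mult.commute)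

lemma symp_form_commute: "symp_form n y x = - symp_form n x y"
  by (simp add: symp_form_def sum_negf [symmetric] mult.commute)

lemma symp_form_add_right:
  "symp_form n x (\<lambda>t. y t + z t) = symp_form n x y + symp_form n x z"
  by (simp add: symp_form_def sum.distrib [symmetric] algebra_simps)

lemma symp_form_add_left:
  "symp_form n (\<lambda>t. y t + z t) x = symp_form n y x + symp_form n z x"
  by (simp add: symp_form_def sum.distrib [symmetric] algebra_simps)

lemma symp_form_scale_right: "symp_form n x (\<lambda>t. a * y t) = a * symp_form n x y"
  by (simp add: symp_form_def sum_distrib_left algebra_simps)

lemma symp_form_scale_left: "symp_form n (\<lambda>t. a * y t) x = a * symp_form n y x"
  by (simp add: symp_form_def sum_distrib_left algebra_simps)

lemma symp_form_scale_right': "symp_form n x (\<lambda>t. y t * a) = a * symp_form n x y"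
  using symp_form_scale_right [of n x a y] by (simp add: mult.commute)

lemma symp_form_scale_left': "symp_form n (\<lambda>t. y t * a) x = a * symp_form n y x"
  using symp_form_scale_left [of n a y x] by (simp add: mult.commute)

lemma symp_form_minus_right: "symp_form n x (\<lambda>t. - y t) = - symp_form n x y"
  using symp_form_scale_right [of n x "-1" y] by simp

lemma symp_form_minus_left: "symp_form n (\<lambda>t. - y t) x = - symp_form n y x"
  using symp_form_scale_left [of n "-1" y x] by simp

lemma symp_form_diff_right:
  "symp_form n x (\<lambda>t. y t - z t) = symp_form n x y - symp_form n x z"
  using symp_form_add_right [of n x y "\<lambda>t. - z t"] by (simp add: symp_form_minus_right)

lemma symp_form_diff_left:
  "symp_form n (\<lambda>t. y t - z t) x = symp_form n y x - symp_form n z x"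
  using symp_form_add_left [of n y "\<lambda>t. - z t" x] by (simp add: symp_form_minus_left)

lemmas symp_form_linear =
  symp_form_add_left symp_form_add_right symp_form_diff_left symp_form_diff_right
  symp_form_minus_left symp_form_minus_right symp_form_scale_left symp_form_scale_right
  symp_form_scale_left' symp_form_scale_right'

lemma covec_add: "covec (\<lambda>t. x t + y t) s = covec x s + covec y s"
  by (simp add: covec_def)

lemma covec_scale: "covec (\<lambda>t. a * x t) s = a * covec x s"
  by (simp add: covec_def)

lemma covec_scale': "covec (\<lambda>t. x t * a) s = a * covec x s"
  by (simp add: covec_def)

lemmas covec_linear = covec_add covec_scale covec_scale'

lemma eichler_carrier [simp]: "eichler n x y \<in> carrier_mat (2 * n) (2 * n)"
  by (simp add: eichler_def)

lemma eichler_dim [simp]: "dim_row (eichler n x y) = 2 * n" "dim_col (eichler n x y) = 2 * n"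
  by (simp_all add: eichler_def)

lemma eichler_commute: "eichler n x y = eichler n y x"
  by (rule eq_matI) (simp_all add: eichler_def)

text \<open>Both rank-one terms are bilinear, so a family of scalar multiples can be read as varying
  in either argument.\<close>

lemma eichler_scale: "eichler n (\<lambda>t. a * x t) y = eichler n x (\<lambda>t. a * y t)"
  by (simp add: eichler_def covec_scale algebra_simps)

lemma eichler_scale_index:
  assumes "r < 2 * n" "s < 2 * n"
  shows "eichler n (\<lambda>t. a * x t) y $$ (r, s) =
    (if r = s then 1 else 0) + a * (x r * covec y s + y r * covec x s)"
  using assms by (simp add: eichler_def covec_scale algebra_simps)

lemma eichler_mult_index:
  assumes "r < 2 * n" "s < 2 * n"
  shows "(eichler n u v * eichler n w z) $$ (r, s) =
    (if r = s then 1 else 0) + u r * covec v s + v r * covec u s + w r * covec z s + z r * covec w s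
    + symp_form n v w * u r * covec z s + symp_form n v z * u r * covec w s
    + symp_form n u w * v r * covec z s + symp_form n u z * v r * covec w s"
proof -
  let ?d = "\<lambda>i j. if i = j then 1 else 0 :: 'a"
  have "(eichler n u v * eichler n w z) $$ (r, s) =
    (\<Sum>t<2 * n. (?d r t + u r * covec v t + v r * covec u t) *
                (?d t s + w t * covec z s + z t * covec w s))"
    using assms by (simp add: eichler_def scalar_prod_def lessThan_atLeast0)
  also have "\<dots> = (\<Sum>t<2 * n. (if r = t then ?d t s + w t * covec z s + z t * covec w s else 0)
      + (if t = s then u r * covec v t + v r * covec u t else 0)
      + u r * covec z s * (covec v t * w t) + u r * covec w s * (covec v t * z t)
      + v r * covec z s * (covec u t * w t) + v r * covec w s * (covec u t * z t))"
    by (intro sum.cong) (auto simp: algebra_simps)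
  also have "\<dots> = ?d r s + w r * covec z s + z r * covec w s
      + (u r * covec v s + v r * covec u s)
      + u r * covec z s * symp_form n v w + u r * covec w s * symp_form n v z
      + v r * covec z s * symp_form n u w + v r * covec w s * symp_form n u z"
    using assms by (simp add: sum.distrib sum_covec sum_distrib_left [symmetric])
  finally show ?thesis by (simp add: algebra_simps)
qed

lemma eichler_zero: "eichler n u (\<lambda>t. 0) = 1\<^sub>m (2 * n)"
  by (rule eq_matI) (auto simp: eichler_def covec_def)

text \<open>With \<open>u\<close> in both factors, the only surviving cross term is
  \<open>symp_form n v w * u r * covec u s\<close>. Adding \<open>c * u\<close> to the second
  argument contributes \<open>c * u r * covec u s\<close> twice, hence the factor
  \<open>h\<close>.\<close>

lemma eichler_mult_common:
  assumes "symp_form n u v = 0" "symp_form n u w = 0" "2 * h = 1"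
  shows "eichler n u v * eichler n u w =
         eichler n u (\<lambda>t. (v t + w t) + (h * symp_form n v w) * u t)"
proof (rule eq_matI)
  fix r s assume "r < dim_row (eichler n u (\<lambda>t. (v t + w t) + (h * symp_form n v w) * u t))"
    "s < dim_col (eichler n u (\<lambda>t. (v t + w t) + (h * symp_form n v w) * u t))"
  then have rs: "r < 2 * n" "s < 2 * n" by auto
  have "symp_form n v u = 0" using assms(1) symp_form_commute [of n v u] by simp
  then have "(eichler n u v * eichler n u w) $$ (r, s) =
    (if r = s then 1 else 0) + u r * covec v s + v r * covec u s + u r * covec w s + w r * covec u s
    + (2 * h) * (symp_form n v w * u r * covec u s)"
    using rs assms by (simp add: eichler_mult_index del: index_mult_mat)
  also have "\<dots> = eichler n u (\<lambda>t. (v t + w t) + (h * symp_form n v w) * u t) $$ (r, s)"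
    using rs by (simp add: eichler_def covec_linear algebra_simps)
  finally show "(eichler n u v * eichler n u w) $$ (r, s) =
    eichler n u (\<lambda>t. (v t + w t) + (h * symp_form n v w) * u t) $$ (r, s)" .
qed simp_all

text \<open>An isometry g satisfies g T(u, v) = T(g u, g v) g. Here g = T(w, z) fixes
  \<open>u\<close> and sends \<open>v\<close> to \<open>v + symp_form n w v * z\<close>.\<close>

lemma eichler_conj:
  assumes "symp_form n u w = 0" "symp_form n u z = 0" "symp_form n z v = 0"
    "symp_form n w z = 0"
  shows "eichler n w z * eichler n u v =
         eichler n u (\<lambda>t. v t + symp_form n w v * z t) * eichler n w z"
proof (rule eq_matI)
  fix r s assume "r < dim_row (eichler n u (\<lambda>t. v t + symp_form n w v * z t) * eichler n w z)"
    "s < dim_col (eichler n u (\<lambda>t. v t + symp_form n w v * z t) * eichler n w z)"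
  then have rs: "r < 2 * n" "s < 2 * n" by auto
  have *: "symp_form n w u = 0" "symp_form n z u = 0" "symp_form n v z = 0" "symp_form n z w = 0"
     "symp_form n v w = - symp_form n w v"
    using assms symp_form_commute [of n w u] symp_form_commute [of n z u]
      symp_form_commute [of n v z] symp_form_commute [of n z w] symp_form_commute [of n v w]
    by auto
  show "(eichler n w z * eichler n u v) $$ (r, s) =
    (eichler n u (\<lambda>t. v t + symp_form n w v * z t) * eichler n w z) $$ (r, s)"
    using rs assms * by (simp add: eichler_mult_index covec_linear symp_form_linear algebra_simps
        del: index_mult_mat)
qed simp_all

section \<open>Change of basis inside a multiplicatively closed set\<close>

text \<open>\<open>K\<close> stands for each of the two generated groups in turn, so the same
  arguments serve both inclusions.\<close>

locale mult_closed =
  fixes n :: nat and K :: "'a :: comm_ring_1 mat set" and h :: 'a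
  assumes closed: "A \<in> K \<Longrightarrow> B \<in> K \<Longrightarrow> A * B \<in> K"
    and half: "2 * h = 1"
begin

text \<open>Negating both \<open>g * b\<close> and \<open>c\<close> keeps the correction
  \<open>d * u\<close> from \<open>eichler_mult_common\<close>, while the linear parts cancel.
  Multiplying the two products therefore leaves T(u, 2 d u).\<close>

lemma eichler_self_mem:
  assumes "\<And>a. eichler n u (\<lambda>t. a * b t) \<in> K" "\<And>a. eichler n u (\<lambda>t. a * c t) \<in> K"
    and orth: "symp_form n u b = 0" "symp_form n u c = 0" and unit: "symp_form n b c dvd 1"
  shows "eichler n u (\<lambda>t. a * u t) \<in> K"
proof -
  obtain e where e: "symp_form n b c * e = 1" using unit by (metis dvdE)
  \<comment> \<open>As \<open>e\<close> inverts \<open>symp_form n b c\<close>, this choice gives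
    \<open>2 * d = a\<close>.\<close>
  define g where "g = a * e"
  define d where "d = h * g * symp_form n b c"
  have swap: "symp_form n c b = - symp_form n b c" by (rule symp_form_commute)
  have "eichler n u (\<lambda>t. g * b t) * eichler n u (\<lambda>t. 1 * c t) =
        eichler n u (\<lambda>t. (g * b t + 1 * c t) + d * u t)"
    using orth half by (simp add: eichler_mult_common symp_form_linear d_def mult.assoc)
  moreover have "eichler n u (\<lambda>t. (-g) * b t) * eichler n u (\<lambda>t. (-1) * c t) =
        eichler n u (\<lambda>t. ((-g) * b t + (-1) * c t) + d * u t)"
    using orth half by (subst eichler_mult_common) (simp_all add: symp_form_linear d_def mult.assoc)
  moreover have "eichler n u (\<lambda>t. (g * b t + 1 * c t) + d * u t) *
        eichler n u (\<lambda>t. ((-g) * b t + (-1) * c t) + d * u t) = eichler n u (\<lambda>t. a * u t)"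
  proof -
    have bu: "symp_form n b u = 0" "symp_form n c u = 0"
      using orth symp_form_commute [of n b u] symp_form_commute [of n c u] by auto
    have "2 * d = a * (symp_form n b c * e) * (2 * h)" by (simp add: d_def g_def algebra_simps)
    then have "d + d = a" using e half by simp
    then have "d * u t + d * u t = a * u t" for t by (simp add: distrib_right [symmetric])
    then have sum: "(g * b t + 1 * c t) + d * u t + (((-g) * b t + (-1) * c t) + d * u t) = a * u t"
      for t by (simp add: add.assoc)
    have "symp_form n (\<lambda>t. (g * b t + 1 * c t) + d * u t)
        (\<lambda>t. ((-g) * b t + (-1) * c t) + d * u t) = 0"
      using swap orth bu by (simp add: symp_form_linear)
    then show ?thesis
      using orth half sum by (subst eichler_mult_common [where h = h]) (simp_all add: symp_form_linear)
  qed
  ultimately have "eichler n u (\<lambda>t. a * u t) =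
      (eichler n u (\<lambda>t. g * b t) * eichler n u (\<lambda>t. 1 * c t)) *
      (eichler n u (\<lambda>t. (-g) * b t) * eichler n u (\<lambda>t. (-1) * c t))"
    by simp
  then show ?thesis using closed assms(1,2) by presburger
qed

text \<open>T(u, p b) T(u, q c) has the desired second argument up to a multiple of
  \<open>u\<close>, which \<open>eichler_self_mem\<close> removes.\<close>

lemma eichler_span_mem:
  assumes "\<And>a. eichler n u (\<lambda>t. a * b t) \<in> K" "\<And>a. eichler n u (\<lambda>t. a * c t) \<in> K"
    and orth: "symp_form n u b = 0" "symp_form n u c = 0" and unit: "symp_form n b c dvd 1"
  shows "eichler n u (\<lambda>t. p * b t + q * c t) \<in> K"
proof -
  define d where "d = h * symp_form n (\<lambda>t. p * b t) (\<lambda>t. q * c t)"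
  have "eichler n u (\<lambda>t. p * b t) * eichler n u (\<lambda>t. q * c t) =
        eichler n u (\<lambda>t. (p * b t + q * c t) + d * u t)"
    using orth half by (simp add: eichler_mult_common symp_form_linear d_def)
  moreover have "eichler n u (\<lambda>t. (p * b t + q * c t) + d * u t) * eichler n u (\<lambda>t. (- d) * u t)
      = eichler n u (\<lambda>t. p * b t + q * c t)"
  proof -
    have bu: "symp_form n b u = 0" "symp_form n c u = 0"
      using orth symp_form_commute [of n b u] symp_form_commute [of n c u] by auto
    show ?thesis
      using orth half bu
      by (subst eichler_mult_common [where h = h])
        (simp_all add: symp_form_linear)
  qed
  ultimately show ?thesis
    using assms(1,2) closed eichler_self_mem [OF assms] by metis
qed

text \<open>\<open>eichler_span_mem\<close> is applied once per argument: first with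
  \<open>b\<close> or \<open>b'\<close> as the fixed vector, then, after exchanging arguments, with
  \<open>?w\<close> fixed.\<close>

lemma eichler_plane_mem:
  assumes mem: "\<And>a x y. x \<in> {b, b'} \<Longrightarrow> y \<in> {c, c'} \<Longrightarrow> eichler n (\<lambda>t. a * x t) y \<in> K"
    and orth: "\<And>x y. x \<in> {b, b'} \<Longrightarrow> y \<in> {c, c'} \<Longrightarrow> symp_form n x y = 0"
    and unit: "symp_form n b b' dvd 1" "symp_form n c c' dvd 1"
  shows "eichler n (\<lambda>t. p * b t + p' * b' t) (\<lambda>t. q * c t + q' * c' t) \<in> K"
proof -
  let ?w = "\<lambda>t. q * c t + q' * c' t"
  have w: "eichler n x (\<lambda>t. q * c t + q' * c' t) \<in> K" if "x \<in> {b, b'}" for x q q'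
    using mem [OF that] orth [OF that] unit(2)
    by (intro eichler_span_mem) (simp_all add: eichler_scale)
  have "eichler n ?w (\<lambda>t. a * x t) \<in> K" if "x \<in> {b, b'}" for x a
    using w [OF that, of "a * q" "a * q'"]
    by (subst eichler_commute) (simp add: eichler_scale algebra_simps)
  moreover have "symp_form n ?w x = 0" if "x \<in> {b, b'}" for x
    using orth [OF that] symp_form_commute [of n ?w x] by (simp add: symp_form_linear)
  ultimately show ?thesis
    using unit(1) by (subst eichler_commute) (intro eichler_span_mem, auto)
qed

text \<open>T(w, -z) is the inverse of T(w, z) because \<open>w\<close> and \<open>z\<close> are
  orthogonal, so \<open>eichler_conj\<close> becomes a product of three members of
  \<open>K\<close>.\<close>

lemma eichler_conj_mem:
  assumes "eichler n w z \<in> K" "eichler n u v \<in> K" "eichler n w (\<lambda>t. - z t) \<in> K"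
    and "symp_form n u w = 0" "symp_form n u z = 0" "symp_form n z v = 0" "symp_form n w z = 0"
  shows "eichler n u (\<lambda>t. v t + symp_form n w v * z t) \<in> K"
proof -
  let ?A = "eichler n u (\<lambda>t. v t + symp_form n w v * z t)"
  have neg: "symp_form n w (\<lambda>t. - z t) = 0" "symp_form n z (\<lambda>t. - z t) = 0"
    using assms symp_form_scale_right [of n _ "-1" z] by simp_all
  have "(eichler n w z * eichler n u v) * eichler n w (\<lambda>t. - z t) =
        (?A * eichler n w z) * eichler n w (\<lambda>t. - z t)"
    using assms by (simp add: eichler_conj)
  also have "\<dots> = ?A * (eichler n w z * eichler n w (\<lambda>t. - z t))"
    by (rule assoc_mult_mat [of _ "2 * n" "2 * n" _ "2 * n" _ "2 * n"]) auto
  also have "eichler n w z * eichler n w (\<lambda>t. - z t) = 1\<^sub>m (2 * n)"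
    using neg assms half by (subst eichler_mult_common [where h = h]) (simp_all add: eichler_zero)
  also have "?A * 1\<^sub>m (2 * n) = ?A" by (rule right_mult_one_mat [of _ "2 * n"]) simp
  finally show ?thesis using closed assms(1-3) by metis
qed

end

section \<open>The form on the standard basis and invariance of \<open>psi\<close>\<close>

lemma covec_basis_fun:
  "covec (basis_fun i) j = (-1) ^ i * basis_fun (swap_index i) j"
proof -
  have "j = swap_index i \<longleftrightarrow> (if even j then j + 1 = i else j - 1 = i)"
    unfolding swap_index_def by presburger
  moreover have "even i \<longleftrightarrow> odd j" if "j = swap_index i"
    using that unfolding swap_index_def by presburger
  ultimately show ?thesis by (auto simp: covec_def basis_fun_def)
qed

lemma symp_form_basis_right:
  assumes "s < 2 * n"
  shows "symp_form n x (basis_fun s) = covec x s"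
proof -
  have "symp_form n x (basis_fun s) = (\<Sum>t<2 * n. if t = s then covec x t else 0)"
    unfolding sum_covec [symmetric] by (intro sum.cong) (auto simp: basis_fun_def)
  then show ?thesis using assms by simp
qed

lemma symp_form_basis_left:
  assumes "s < 2 * n"
  shows "symp_form n (basis_fun s) x = - covec x s"
  using symp_form_commute [of n "basis_fun s" x] assms by (simp add: symp_form_basis_right)

lemma symp_form_basis:
  assumes "j < 2 * n"
  shows "symp_form n (basis_fun i) (basis_fun j) = (-1) ^ i * basis_fun (swap_index i) j"
  using assms by (simp add: symp_form_basis_right covec_basis_fun)

text \<open>The induction peels off the first diagonal block; the entry formula is unchanged when
  both indices shift by 2.\<close>

lemma psi_index:
  "r < 2 * n \<Longrightarrow> s < 2 * n \<Longrightarrow> (psi n :: 'a :: comm_ring_1 mat) $$ (r, s) = covec (basis_fun r) s"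
proof (induction n arbitrary: r s)
  case (Suc n)
  have psi: "(psi (Suc n) :: 'a mat) =
      four_block_mat psi1 (0\<^sub>m 2 (2 * n)) (0\<^sub>m (2 * n) 2) (psi n)"
    using psi_carrier [of n, where 'a = 'a]
    by (auto simp: psi_def Let_def psi1_def mat_of_rows_list_def numeral_2_eq_2)
  have dims: "dim_row (psi n :: 'a mat) = 2 * n" "dim_col (psi n :: 'a mat) = 2 * n"
    using psi_carrier [of n, where 'a = 'a] by auto
  have shift: "covec (basis_fun (r - 2)) (s - 2) = (covec (basis_fun r) s :: 'a)"
    if rs: "r \<ge> 2" "s \<ge> 2"
  proof -
    obtain r' s' where "r = r' + 2" "s = s' + 2" using rs by (metis le_add_diff_inverse2)
    then show ?thesis by (cases s') (auto simp: covec_def basis_fun_def)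
  qed
  consider "r < 2" "s < 2" | "r < 2" "s \<ge> 2" | "r \<ge> 2" "s < 2" | "r \<ge> 2" "s \<ge> 2" by linarith
  then show ?case
  proof cases
    case 1
    then show ?thesis
      by (auto simp: psi psi1_def mat_of_rows_list_def dims covec_def basis_fun_def less_2_cases_iff)
  next
    case 2
    then show ?thesis using Suc.prems
      by (auto simp: psi psi1_def mat_of_rows_list_def dims covec_def basis_fun_def) presburger
  next
    case 3
    then show ?thesis using Suc.prems
      by (auto simp: psi psi1_def mat_of_rows_list_def dims covec_def basis_fun_def)
  next
    case 4
    then have "(psi (Suc n) :: 'a mat) $$ (r, s) = psi n $$ (r - 2, s - 2)"
      using Suc.prems by (simp add: psi psi1_def mat_of_rows_list_def dims numeral_2_eq_2)
    then show ?thesis using Suc 4 shift by simp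
  qed
qed simp

text \<open>Entry \<open>(r, s)\<close> of the product is the form evaluated on columns
  \<open>c r\<close> and \<open>c s\<close> of the Eichler matrix. In its expansion the linear cross
  terms cancel in pairs, and orthogonality of \<open>x\<close> and \<open>y\<close> kills the
  quadratic ones.\<close>

lemma eichler_preserves_psi:
  assumes "symp_form n x y = 0"
  shows "transpose_mat (eichler n x y) * psi n * eichler n x y = (psi n :: 'a :: comm_ring_1 mat)"
proof (rule eq_matI)
  let ?E = "eichler n x y"
  define c where "c s = (\<lambda>t. basis_fun s t + (covec y s * x t + covec x s * y t))" for s
  note p = psi_carrier [of n, where 'a = 'a]
  fix r s assume "r < dim_row (psi n :: 'a mat)" "s < dim_col (psi n :: 'a mat)"
  then have rs: "r < 2 * n" "s < 2 * n" using p by auto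
  have E: "?E $$ (t, s) = c s t" if "t < 2 * n" "s < 2 * n" for s t
    using that by (simp add: eichler_def c_def basis_fun_def algebra_simps)
  have psiE: "(psi n * ?E) $$ (t, s) = - covec (c s) t" if "t < 2 * n" for t
  proof -
    have "(psi n * ?E) $$ (t, s) = (\<Sum>k<2 * n. covec (basis_fun t) k * c s k)"
      using that rs p E by (auto simp: scalar_prod_def lessThan_atLeast0 psi_index intro!: sum.cong)
    then show ?thesis using that by (simp add: sum_covec symp_form_basis_left)
  qed
  have "(transpose_mat ?E * psi n * ?E) $$ (r, s) = (transpose_mat ?E * (psi n * ?E)) $$ (r, s)"
    using p by (simp add: assoc_mult_mat [of _ "2 * n" "2 * n" _ "2 * n" _ "2 * n"])
  also have "\<dots> = (\<Sum>t<2 * n. ?E $$ (t, r) * (psi n * ?E) $$ (t, s))"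
    using rs p by (auto simp: scalar_prod_def lessThan_atLeast0 intro!: sum.cong)
  also have "\<dots> = - (\<Sum>t<2 * n. covec (c s) t * c r t)"
    unfolding sum_negf [symmetric]
    using E psiE rs by (intro sum.cong) (auto simp del: index_mult_mat)
  also have "\<dots> = symp_form n (c r) (c s)"
    unfolding sum_covec using symp_form_commute [of n "c r" "c s"] by simp
  also have "\<dots> = symp_form n (basis_fun r) (basis_fun s)"
    using assms rs symp_form_commute [of n y x]
    by (simp add: c_def symp_form_linear covec_linear symp_form_basis_left symp_form_basis_right algebra_simps)
  also have "\<dots> = psi n $$ (r, s)"
    using rs by (simp add: psi_index symp_form_basis_right)
  finally show "(transpose_mat ?E * psi n * ?E) $$ (r, s) = psi n $$ (r, s)" .
qed (use psi_carrier [of n, where 'a = 'a] in auto)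

section \<open>Elementary generators as Eichler transformations, and their determinants\<close>

lemma swap_index_swap [simp]: "swap_index (swap_index i) = i"
  by (auto simp: swap_index_def)

lemma swap_index_less [simp]: "swap_index i < 2 * n \<longleftrightarrow> i < 2 * n"
  by (auto simp: swap_index_def elim!: oddE evenE)

lemma swap_index_neq [simp]: "swap_index i \<noteq> i" "i \<noteq> swap_index i"
  by (auto simp: swap_index_def elim!: oddE)

lemma minus_one_power_swap: "(-1 :: 'a :: comm_ring_1) ^ swap_index i = - ((-1) ^ i)"
  by (auto simp: swap_index_def)

lemma unit_mat_index:
  "r < 2 * n \<Longrightarrow> s < 2 * n \<Longrightarrow> unit_mat n i j $$ (r, s) = basis_fun i r * basis_fun j s"
  by (simp add: unit_mat_def basis_fun_def)

lemma unit_mat_dim [simp]: "dim_row (unit_mat n i j) = 2 * n" "dim_col (unit_mat n i j) = 2 * n"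
  by (simp_all add: unit_mat_def)

text \<open>\<open>covec (basis_fun (swap_index j))\<close> is \<open>basis_fun j\<close> with sign
  \<open>(-1) ^ (j + 1)\<close>; repeating the sign in the scalar leaves \<open>x\<close> at
  \<open>(i, j)\<close>.\<close>

lemma symp_elem_mat_eq_eichler:
  "symp_elem_mat n i j x =
   eichler n (\<lambda>t. ((-1) ^ (j + 1) * x) * basis_fun i t) (basis_fun (swap_index j))"
proof -
  have sign: "(- 1) ^ j * x * (p * ((- 1) ^ j * q)) = x * (p * q)" for p q :: 'a
    using left_minus_one_mult_self [of j "x * (p * q)"] by (simp add: ac_simps)
  show ?thesis
  proof (rule eq_matI)
    fix r s
    let ?E = "eichler n (\<lambda>t. ((-1) ^ (j + 1) * x) * basis_fun i t) (basis_fun (swap_index j))"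
    assume "r < dim_row ?E" "s < dim_col ?E"
    then have rs: "r < 2 * n" "s < 2 * n" by auto
    show "symp_elem_mat n i j x $$ (r, s) = ?E $$ (r, s)"
      unfolding eichler_scale_index [OF rs] covec_basis_fun
      using rs sign by (simp add: symp_elem_mat_def unit_mat_index minus_one_power_swap power_add
        right_diff_distrib)
  qed (simp_all add: symp_elem_mat_def)
qed

text \<open>With equal arguments the two rank-one terms coincide, so the scalar is halved; its sign
  cancels that of \<open>covec (basis_fun i)\<close>.\<close>

lemma elem_mat_eq_eichler:
  assumes "2 * h = 1"
  shows "elem_mat n i (swap_index i) x =
    eichler n (\<lambda>t. ((-1) ^ i * (h * x)) * basis_fun i t) (basis_fun i)"
proof -
  have "e * (h * x) * (2 * (p * (e * q))) = (2 * h) * (e * e) * (x * (p * q))"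
    for e p q by (simp add: ac_simps)
  then have "(-1) ^ i * (h * x) * (2 * (p * ((-1) ^ i * q))) = x * (p * q)" for p q
    using assms by simp
  then show ?thesis
    by (intro eq_matI)
      (simp_all add: elem_mat_def unit_mat_index eichler_scale_index covec_basis_fun)
qed

lemma det_elem_mat: "i \<noteq> j \<Longrightarrow> det (elem_mat n i j x) = 1"
proof -
  assume "i \<noteq> j"
  moreover have "elem_mat n i j x = addrow_mat (2 * n) x i j"
    by (rule eq_matI) (auto simp: elem_mat_def unit_mat_def addrow_mat_def)
  ultimately show ?thesis by (simp add: det_addrow_mat)
qed

text \<open>One row addition produces the matrix from the transvection \<open>?B\<close>: row
  \<open>j\<close> of \<open>?B\<close> is still that of the identity, since
  \<open>swap_index j \<noteq> j\<close>.\<close>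

lemma det_symp_elem_mat:
  assumes "i < 2 * n" "j < 2 * n" "i \<noteq> j" "j \<noteq> swap_index i"
  shows "det (symp_elem_mat n i j x) = 1"
proof -
  let ?B = "elem_mat n (swap_index j) (swap_index i) (- ((-1) ^ (i + j) * x))"
  have ij: "swap_index j \<noteq> swap_index i" using assms(3) by (metis swap_index_swap)
  have "i \<noteq> swap_index j" using assms(4) by auto
  then have "symp_elem_mat n i j x = addrow x i j ?B"
    using assms by (intro eq_matI) (auto simp: symp_elem_mat_def elem_mat_def unit_mat_def)
  moreover have "?B \<in> carrier_mat (2 * n) (2 * n)"
    by (auto simp: elem_mat_def unit_mat_def)
  ultimately show ?thesis
    using assms ij by (simp add: det_addrow [of _ "2 * n"] det_elem_mat)
qed

lemma symp_form_basis_orth: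
  assumes "j < 2 * n" "i div 2 \<noteq> j div 2"
  shows "symp_form n (basis_fun i) (basis_fun j) = 0"
proof -
  have "swap_index i \<noteq> j" using assms(2) unfolding swap_index_def by presburger
  then show ?thesis using assms(1) by (auto simp: symp_form_basis basis_fun_def)
qed

section \<open>Hyperbolic bases and the generators of \<open>H\<close>\<close>

text \<open>
  The blocks \<open>A\<close>, \<open>B\<close>, \<open>C\<close>, \<open>D\<close> are, up to scalars, the products of a column and a row, each of them
  \<open>(1, 1)\<close> or \<open>(1, -1)\<close>; \<open>\<psi>\<close> exchanges the last two up to sign.
\<close>

definition hyp_sum :: "nat \<Rightarrow> nat \<Rightarrow> 'a :: comm_ring_1" where
  "hyp_sum k t = basis_fun (2 * k) t + basis_fun (2 * k + 1) t"

definition hyp_diff :: "nat \<Rightarrow> nat \<Rightarrow> 'a :: comm_ring_1" where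
  "hyp_diff k t = basis_fun (2 * k) t - basis_fun (2 * k + 1) t"

text \<open>Kronecker deltas replace the case distinction by blocks, so that the entries can be
  compared directly with those of an Eichler matrix. \<open>1 \<le> k\<close> keeps blocks 0 and
  \<open>k\<close> apart.\<close>

lemma symp_block_mat_index:
  fixes x y z w :: "'a :: comm_ring_1"
  assumes "1 \<le> k" "r < 2 * n" "s < 2 * n"
  shows "symp_block_mat n k (mat_of_rows_list 2 [[x, y], [z, w]]) $$ (r, s) =
    basis_fun r s
    + basis_fun 0 r * (x * basis_fun (2 * k) s + y * basis_fun (2 * k + 1) s)
    + basis_fun 1 r * (z * basis_fun (2 * k) s + w * basis_fun (2 * k + 1) s)
    + basis_fun (2 * k) r * (y * basis_fun 1 s - w * basis_fun 0 s)
    + basis_fun (2 * k + 1) r * (z * basis_fun 0 s - x * basis_fun 1 s)"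
proof -
  obtain p where r: "r = 2 * p \<or> r = Suc (2 * p)" by (metis evenE oddE Suc_eq_plus1)
  obtain q where s: "s = 2 * q \<or> s = Suc (2 * q)" by (metis evenE oddE Suc_eq_plus1)
  let ?X = "mat_of_rows_list 2 [[x, y], [z, w]]"
  \<comment> \<open>This is minus the adjugate of \<open>?X\<close>.\<close>
  have "psi1 * transpose_mat ?X * psi1 = mat_of_rows_list 2 [[- w, y], [z, - x]]"
    by (rule eq_matI)
      (auto simp: psi1_def mat_of_rows_list_def scalar_prod_def numeral_2_eq_2 less_Suc_eq)
  moreover have "mat_of_rows_list 2 [[a, b], [c, d]] $$ (0, 0) = a"
    "mat_of_rows_list 2 [[a, b], [c, d]] $$ (0, 1) = b"
    "mat_of_rows_list 2 [[a, b], [c, d]] $$ (1, 0) = c"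
    "mat_of_rows_list 2 [[a, b], [c, d]] $$ (1, 1) = d" for a b c d :: 'a
    by (simp_all add: mat_of_rows_list_def)
  ultimately show ?thesis
    using r s assms
    by (elim disjE; cases "p = 0"; cases "p = k"; cases "q = 0"; cases "q = k")
      (simp_all add: symp_block_mat_def basis_fun_def)
qed

lemma covec_hyp_sum: "covec (hyp_sum k) s = - hyp_diff k s"
proof -
  have "covec (hyp_sum k) s = covec (basis_fun (2 * k)) s + covec (basis_fun (2 * k + 1)) s"
    by (simp add: covec_def hyp_sum_def)
  then show ?thesis by (simp add: covec_basis_fun hyp_diff_def swap_index_def)
qed

lemma covec_hyp_diff: "covec (hyp_diff k) s = hyp_sum k s"
proof -
  have "covec (hyp_diff k) s = covec (basis_fun (2 * k)) s - covec (basis_fun (2 * k + 1)) s"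
    by (simp add: covec_def hyp_diff_def)
  then show ?thesis by (simp add: covec_basis_fun hyp_sum_def swap_index_def add.commute)
qed

text \<open>In block \<open>k\<close>, \<open>covec\<close> turns \<open>hyp_diff k\<close> into the
  row \<open>(1, 1)\<close> and \<open>hyp_sum k\<close> into \<open>(-1, 1)\<close>. The latter
  sign is compensated by \<open>- a\<close> for \<open>block_B\<close> and is already built into
  \<open>block_D\<close>.\<close>

lemma symp_block_mat_eq_eichler:
  fixes a :: "'a :: comm_ring_1"
  assumes "1 \<le> k"
  shows "symp_block_mat n k (block_A a) = eichler n (\<lambda>t. a * hyp_sum 0 t) (hyp_diff k)"
    and "symp_block_mat n k (block_B a) = eichler n (\<lambda>t. - a * hyp_sum 0 t) (hyp_sum k)"
    and "symp_block_mat n k (block_C a) = eichler n (\<lambda>t. a * hyp_diff 0 t) (hyp_diff k)"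
    and "symp_block_mat n k (block_D a) = eichler n (\<lambda>t. a * hyp_diff 0 t) (hyp_sum k)"
  unfolding block_A_def block_B_def block_C_def block_D_def
  by (rule eq_matI;
      (simp only: symp_block_mat_index [OF assms] eichler_scale_index eichler_dim
         covec_hyp_sum covec_hyp_diff)?;
      simp add: symp_block_mat_def hyp_sum_def hyp_diff_def basis_fun_def)+

text \<open>Invertibility of 2 makes this value a unit, as \<open>eichler_plane_mem\<close> requires
  of the pair.\<close>

lemma symp_form_hyp:
  assumes "k < n"
  shows "symp_form n (hyp_sum k) (hyp_diff k) = (- 2 :: 'a :: comm_ring_1)"
proof -
  have "symp_form n (hyp_sum k) (hyp_diff k :: nat \<Rightarrow> 'a) =
      symp_form n (hyp_sum k) (basis_fun (2 * k)) - symp_form n (hyp_sum k) (basis_fun (2 * k + 1))"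
    unfolding hyp_diff_def [abs_def] by (rule symp_form_diff_right)
  then show ?thesis
    using assms
    by (simp add: symp_form_basis_right covec_hyp_sum) (simp add: hyp_diff_def basis_fun_def)
qed

lemma symp_form_hyp_orth:
  fixes x y :: "nat \<Rightarrow> 'a :: comm_ring_1"
  assumes "1 \<le> k" "k < n" "x \<in> {hyp_sum 0, hyp_diff 0}" "y \<in> {hyp_sum k, hyp_diff k}"
  shows "symp_form n x y = 0"
proof -
  have "symp_form n (basis_fun i) (basis_fun j) = (0 :: 'a)" if "i \<in> {0, 1}" "j \<in> {2 * k, 2 * k + 1}"
    for i j using that assms(1,2) by (intro symp_form_basis_orth) auto
  then show ?thesis
    using assms(3,4) by (auto simp: hyp_sum_def [abs_def] hyp_diff_def [abs_def] symp_form_linear)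
qed

section \<open>The two inclusions between the generated groups\<close>

lemma mult_closed_generate:
  "2 * h = 1 \<Longrightarrow> mult_closed (generate (Sp_group n) S) h"
  by unfold_locales (use generate.eng [of _ "Sp_group n" S] in \<open>auto simp: Sp_group_def\<close>)

definition ESp_gens :: "nat \<Rightarrow> 'a :: comm_ring_1 mat set" where
  "ESp_gens n = {elem_mat n 1 0 x | x. True} \<union> {elem_mat n 0 1 x | x. True} \<union>
      {symp_elem_mat n i j x | i j x. i < 2 * n \<and> j < 2 * n \<and> i \<noteq> j \<and> j \<noteq> swap_index i}"

definition H_gens :: "nat \<Rightarrow> 'a :: comm_ring_1 mat set" where
  "H_gens n = {symp_block_mat n k X | k X. 1 \<le> k \<and> k < n \<and>
        (\<exists>a. X \<in> {block_A a, block_B a, block_C a, block_D a})}"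

lemma ESp_eq: "ESp n = generate (Sp_group n) (ESp_gens n)"
  by (simp add: ESp_def ESp_gens_def)

lemma H_eq: "H n = generate (Sp_group n) (H_gens n)"
  by (simp add: H_def H_gens_def)

lemma swap_index_eq_same_block: "i div 2 = j div 2 \<longleftrightarrow> i = j \<or> i = swap_index j"
  by (cases "even i"; cases "even j") (auto simp: swap_index_def elim!: evenE oddE)

lemma ESp_gens_subset_Sp:
  assumes half: "2 * h = (1 :: 'a :: comm_ring_1)"
  shows "(ESp_gens n :: 'a mat set) \<subseteq> carrier (Sp_group n)"
proof -
  have elem: "elem_mat n i (swap_index i) x \<in> Sp n" for i and x :: 'a
    using eichler_preserves_psi [of n "\<lambda>t. ((-1) ^ i * (h * x)) * basis_fun i t" "basis_fun i"]
      det_elem_mat [of i "swap_index i" n x]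
    unfolding Sp_def elem_mat_eq_eichler [OF half] symp_form_linear by simp
  have "symp_elem_mat n i j x \<in> Sp n"
    if "i < 2 * n" "j < 2 * n" "i \<noteq> j" "j \<noteq> swap_index i" for i j and x :: 'a
  proof -
    have "i div 2 \<noteq> swap_index j div 2"
      using that by (auto simp: swap_index_eq_same_block)
    then have "symp_form n (\<lambda>t. ((-1) ^ (j + 1) * x) * basis_fun i t) (basis_fun (swap_index j)) = 0"
      using that unfolding symp_form_linear by (subst symp_form_basis_orth) auto
    from eichler_preserves_psi [OF this] show ?thesis
      using det_symp_elem_mat [OF that, of x]
      by (simp add: Sp_def symp_elem_mat_eq_eichler)
  qed
  moreover have "elem_mat n 0 1 x \<in> Sp n" "elem_mat n 1 0 x \<in> Sp n" for x :: 'a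
    using elem [of 0 x] elem [of 1 x] by (simp_all add: swap_index_def)
  moreover have "carrier (Sp_group n) = (Sp n :: 'a mat set)" by (simp add: Sp_group_def)
  ultimately show ?thesis unfolding ESp_gens_def by blast
qed

lemma H_gens_subset_ESp:
  assumes half: "2 * h = (1 :: 'a :: comm_ring_1)"
  shows "(H_gens n :: 'a mat set) \<subseteq> ESp n"
proof -
  interpret mult_closed n "ESp n :: 'a mat set" h
    unfolding ESp_eq using half by (rule mult_closed_generate)
  have basis: "eichler n (\<lambda>t. a * basis_fun i t) (basis_fun j) \<in> ESp n"
    if "i < 2 * n" "j < 2 * n" "i div 2 \<noteq> j div 2" for i j and a :: 'a
  proof -
    \<comment> \<open>The power of -1 in the scalar cancels the sign from
      \<open>symp_elem_mat_eq_eichler\<close>.\<close>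
    have "symp_elem_mat n i (swap_index j) ((-1) ^ (swap_index j + 1) * a) \<in> ESp_gens n"
    proof -
      have "swap_index j < 2 * n" "i \<noteq> swap_index j" "swap_index j \<noteq> swap_index i"
        using that by (auto simp: swap_index_eq_same_block dest: arg_cong [of _ _ swap_index])
      then show ?thesis using that(1) unfolding ESp_gens_def by blast
    qed
    then show ?thesis
      unfolding symp_elem_mat_eq_eichler ESp_eq
      by (auto simp: generate.incl)
  qed
  have plane: "eichler n (\<lambda>t. p * basis_fun 0 t + p' * basis_fun 1 t)
      (\<lambda>t. q * basis_fun (2 * k) t + q' * basis_fun (2 * k + 1) t) \<in> ESp n"
    if "1 \<le> k" "k < n" for k and p p' q q' :: 'a
    using that
    by (intro eichler_plane_mem)
      (auto simp: basis symp_form_basis_orth symp_form_basis, auto simp: basis_fun_def swap_index_def)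
  have "symp_block_mat n k X \<in> ESp n"
    if "1 \<le> k" "k < n" "X \<in> {block_A a, block_B a, block_C a, block_D a}" for k X and a :: 'a
    \<comment> \<open>The arguments are the coordinates of multiples of \<open>hyp_sum\<close> and
      \<open>hyp_diff\<close> in the standard bases of planes 0 and \<open>k\<close>.\<close>
    using that plane [OF that(1,2), of a a 1 1] plane [OF that(1,2), of "-a" "-a" 1 1]
      plane [OF that(1,2), of a a 1 "-1"] plane [OF that(1,2), of a "-a" 1 1]
      plane [OF that(1,2), of a "-a" 1 "-1"]
    by (auto simp: symp_block_mat_eq_eichler hyp_sum_def [abs_def] hyp_diff_def [abs_def]
        algebra_simps)
  then show ?thesis by (auto simp: H_gens_def)
qed

lemma ESp_gens_subset_H:
  assumes half: "2 * h = (1 :: 'a :: comm_ring_1)" and n: "n \<ge> 2"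
  shows "(ESp_gens n :: 'a mat set) \<subseteq> H n"
proof -
  interpret mult_closed n "H n :: 'a mat set" h
    unfolding H_eq using half by (rule mult_closed_generate)
  have hyp: "eichler n (\<lambda>t. a * x t) y \<in> H n"
    if k: "1 \<le> k" "k < n" and xy: "x \<in> {hyp_sum 0, hyp_diff 0}" "y \<in> {hyp_sum k, hyp_diff k}"
    for k x y and a :: 'a
  proof -
    have "symp_block_mat n k X \<in> H n" if "X \<in> {block_A a, block_B a, block_C a, block_D a}" for X a
      unfolding H_eq by (rule generate.incl) (use that k in \<open>auto simp: H_gens_def\<close>)
    \<comment> \<open>\<open>block_B\<close> is taken at \<open>- a\<close> to undo its sign in
      \<open>symp_block_mat_eq_eichler\<close>.\<close>
    from this [of "block_A a" a] this [of "block_B (- a)" "- a"] this [of "block_C a" a]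
      this [of "block_D a" a]
    show ?thesis using xy k by (auto simp: symp_block_mat_eq_eichler)
  qed
  have two: "(- 2 :: 'a) dvd 1"
    using half by (metis dvdI minus_dvd_iff)
  have plane: "eichler n (\<lambda>t. p * hyp_sum 0 t + p' * hyp_diff 0 t)
      (\<lambda>t. q * hyp_sum k t + q' * hyp_diff k t) \<in> H n"
    if "1 \<le> k" "k < n" for k and p p' q q' :: 'a
    using that two n
    by (intro eichler_plane_mem) (auto simp: hyp symp_form_hyp symp_form_hyp_orth)
  have half2: "h * x + h * x = x" for x
    using half by (metis mult.assoc mult_2 mult_1)
  \<comment> \<open>The standard basis vectors are half the sum and half the difference of
    \<open>hyp_sum k\<close> and \<open>hyp_diff k\<close>.\<close>
  have basis: "(\<lambda>t. a * basis_fun (2 * k) t) = (\<lambda>t. (a * h) * hyp_sum k t + (a * h) * hyp_diff k t)"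
    "(\<lambda>t. a * basis_fun (2 * k + 1) t) =
     (\<lambda>t. (a * h) * hyp_sum k t + (- (a * h)) * hyp_diff k t)" for k and a :: 'a
  proof -
    have "a * h * (p + q) + a * h * (p - q) = a * p" "a * h * (p + q) + (- (a * h)) * (p - q) = a * q"
      for p q using half2 [of "a * p"] half2 [of "a * q"] by (simp_all add: algebra_simps)
    then show "(\<lambda>t. a * basis_fun (2 * k) t) = (\<lambda>t. (a * h) * hyp_sum k t + (a * h) * hyp_diff k t)"
      "(\<lambda>t. a * basis_fun (2 * k + 1) t) =
       (\<lambda>t. (a * h) * hyp_sum k t + (- (a * h)) * hyp_diff k t)"
      unfolding hyp_sum_def hyp_diff_def by presburger+
  qed
  have first: "eichler n (\<lambda>t. a * basis_fun i t) (basis_fun j) \<in> H n"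
    if "i < 2" "j < 2 * n" "2 \<le> j" for i j and a :: 'a
  proof -
    define k where "k = j div 2"
    have k: "1 \<le> k" "k < n" "j = 2 * k \<or> j = 2 * k + 1" using that by (auto simp: k_def)
    \<comment> \<open>The forms \<open>2 * 0\<close> here and \<open>1 * basis_fun j t\<close> below
      let \<open>basis\<close> rewrite both arguments.\<close>
    have i: "i = 2 * 0 \<or> i = 2 * 0 + 1" using that by auto
    have "eichler n (\<lambda>t. a * basis_fun i t) (\<lambda>t. 1 * basis_fun j t) \<in> H n"
      using i k(3) plane [OF k(1,2)] by (elim disjE) (simp_all only: basis)
    then show ?thesis by simp
  qed
  have basis_mem: "eichler n (\<lambda>t. a * basis_fun i t) (basis_fun j) \<in> H n"
    if ij: "i < 2 * n" "j < 2 * n" "i div 2 \<noteq> j div 2" for i j and a :: 'a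
  proof -
    consider "i < 2" | "j < 2" | "i \<ge> 2" "j \<ge> 2" by linarith
    then show ?thesis
    proof cases
      case 1
      then show ?thesis using ij by (intro first) auto
    next
      case 2
      then have "eichler n (\<lambda>t. a * basis_fun j t) (basis_fun i) \<in> H n"
        using ij by (intro first) auto
      then show ?thesis by (metis eichler_commute eichler_scale)
    next
      case 3
      \<comment> \<open>Conjugating T(?u, ?e1) by T(?e0, e_j) adds e_j to the second argument,
        because \<open>symp_form n ?e0 ?e1 = 1\<close>; multiplying by T(?u, -?e1) then strips off
        \<open>?e1\<close>.\<close>
      let ?u = "\<lambda>t. a * basis_fun i t :: 'a" and ?e0 = "basis_fun 0 :: nat \<Rightarrow> 'a"
        and ?e1 = "basis_fun 1 :: nat \<Rightarrow> 'a"
      have orth: "symp_form n (basis_fun i) ?e0 = 0" "symp_form n (basis_fun i) ?e1 = 0"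
        "symp_form n (basis_fun i) (basis_fun j) = (0 :: 'a)"
        "symp_form n (basis_fun j) ?e1 = 0" "symp_form n ?e0 (basis_fun j) = 0"
        using 3 ij n by (simp_all add: symp_form_basis_orth)
      have e01: "symp_form n ?e0 ?e1 = 1"
        using n by (simp add: symp_form_basis swap_index_def basis_fun_def)
      have u1: "eichler n ?u (\<lambda>t. c * ?e1 t) \<in> H n" for c
      proof -
        have "eichler n ?u (\<lambda>t. c * ?e1 t) = eichler n (\<lambda>t. a * (c * ?e1 t)) (basis_fun i)"
          by (subst eichler_scale) (rule eichler_commute)
        also have "\<dots> = eichler n (\<lambda>t. (a * c) * ?e1 t) (basis_fun i)" by (simp add: mult.assoc)
        also have "\<dots> \<in> H n" using 3 ij by (intro first) auto
        finally show ?thesis .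
      qed
      have e0j: "eichler n ?e0 (\<lambda>t. c * basis_fun j t) \<in> H n" for c
        using first [of 0 j c] 3 ij by (simp add: eichler_scale)
      have "eichler n ?u (\<lambda>t. ?e1 t + symp_form n ?e0 ?e1 * basis_fun j t) \<in> H n"
        using u1 [of 1] e0j [of 1] e0j [of "-1"] orth
        by (intro eichler_conj_mem) (simp_all add: symp_form_linear)
      then have "eichler n ?u (\<lambda>t. ?e1 t + basis_fun j t) * eichler n ?u (\<lambda>t. (-1) * ?e1 t) \<in> H n"
        using u1 [of "-1"] e01 by (intro closed) simp_all
      moreover have "eichler n ?u (\<lambda>t. ?e1 t + basis_fun j t) * eichler n ?u (\<lambda>t. (-1) * ?e1 t) =
          eichler n ?u (basis_fun j)"
        using orth half by (subst eichler_mult_common [where h = h]) (simp_all add: symp_form_linear)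
      ultimately show ?thesis by simp
    qed
  qed
  \<comment> \<open>The vectors with indices 2 and 3 form a hyperbolic pair orthogonal to
    \<open>basis_fun i\<close>, available because \<open>n \<ge> 2\<close>; they feed
    \<open>eichler_self_mem\<close>.\<close>
  have self: "eichler n (\<lambda>t. a * basis_fun i t) (basis_fun i) \<in> H n" if "i < 2" for i and a :: 'a
  proof -
    have "eichler n (basis_fun i) (\<lambda>t. a * basis_fun i t) \<in> H n"
    proof (rule eichler_self_mem)
      show "eichler n (basis_fun i) (\<lambda>t. c * basis_fun 2 t) \<in> H n"
        "eichler n (basis_fun i) (\<lambda>t. c * basis_fun 3 t) \<in> H n" for c :: 'a
        using first [OF that, of 2 c] first [OF that, of 3 c] n by (simp_all add: eichler_scale)
      show "symp_form n (basis_fun i) (basis_fun 2) = (0 :: 'a)"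
        "symp_form n (basis_fun i) (basis_fun 3) = (0 :: 'a)"
        using that n by (simp_all add: symp_form_basis_orth)
      show "symp_form n (basis_fun 2) (basis_fun 3) dvd (1 :: 'a)"
        using n by (simp add: symp_form_basis swap_index_def basis_fun_def)
    qed
    then show ?thesis by (simp add: eichler_scale)
  qed
  have "symp_elem_mat n i j x \<in> H n"
    if "i < 2 * n" "j < 2 * n" "i \<noteq> j" "j \<noteq> swap_index i" for i j and x :: 'a
    unfolding symp_elem_mat_eq_eichler
    using that by (intro basis_mem) (auto simp: swap_index_eq_same_block)
  moreover have "elem_mat n i (swap_index i) x \<in> H n" if "i < 2" for i and x :: 'a
    unfolding elem_mat_eq_eichler [OF half] using that by (rule self)
  from this [of 0] this [of 1] have "elem_mat n 0 1 x \<in> H n" "elem_mat n 1 0 x \<in> H n" for x :: 'a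
    by (simp_all add: swap_index_def)
  ultimately show ?thesis by (auto simp: ESp_gens_def)
qed

theorem theorem3p2:
  fixes n :: nat
  assumes "n \<ge> 2" and "(2 :: 'a :: comm_ring_1) dvd 1"
  shows "(ESp n :: 'a mat set) = H n"
proof
  obtain h where half: "2 * h = (1 :: 'a)" using assms(2) by (metis dvdE)
  interpret group "Sp_group n :: 'a mat monoid" by (rule group_Sp)
  have ESp: "subgroup (ESp n :: 'a mat set) (Sp_group n)"
    unfolding ESp_eq by (rule generate_is_subgroup [OF ESp_gens_subset_Sp [OF half]])
  show "H n \<subseteq> (ESp n :: 'a mat set)"
    unfolding H_eq by (rule generate_subgroup_incl [OF H_gens_subset_ESp [OF half] ESp])
  \<comment> \<open>The block matrices inherit membership in \<open>Sp n\<close>, including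
    determinant 1, from the inclusion in \<open>ESp n\<close>.\<close>
  have "(H_gens n :: 'a mat set) \<subseteq> carrier (Sp_group n)"
    using H_gens_subset_ESp [OF half] subgroup.subset [OF ESp] by (rule subset_trans)
  then have "subgroup (H n :: 'a mat set) (Sp_group n)"
    unfolding H_eq by (rule generate_is_subgroup)
  then show "(ESp n :: 'a mat set) \<subseteq> H n"
    unfolding ESp_eq by (rule generate_subgroup_incl [OF ESp_gens_subset_H [OF half assms(1)]])
qed

end
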